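(* Let $X,V\in\mathfrak{u}_n$ and let $\|\cdot\|$ be an $\mathrm{Ad}$-invariant Finsler norm on $\mathfrak{u}_n$. Then for all real $0\le s\le s'$, $$\|V\|\le\|V-s[X,[X,V]]\|\le\|V-s'[X,[X,V]]\|,$$ and for all real $t,t'$ with $t\neq 0$ and $t'/t\ge 1$, $$\|V\|\le\|V+t[X,V]\|\le\|V+t'[X,V]\|.$$
   Context: $\mathfrak{u}_n$ is the real vector space of $n\times n$ complex skew-Hermitian matrices, $\mathbf{U}_n$ the group of $n\times n$ unitary matrices, $[A,B]=AB-BA$. An $\mathrm{Ad}$-invariant Finsler norm on $\mathfrak{u}_n$ is a function $\|\cdot\|:\mathfrak{u}_n\to\mathbb{R}_{\ge 0}$ such that for all $X,Y\in\mathfrak{u}_n$: $\|X\|=0$ iff $X=0$; $\|X+Y\|\le\|X\|+\|Y\|$; $\|\lambda X\|=\lambda\|X\|$ for all real $\lambda\ge 0$ (full homogeneity is not required); $\|UXU^*\|=\|X\|$ for all $U\in\mathbf{U}_n$. *)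

theory Defs
  imports "HOL-Analysis.Analysis"
begin

definition conj_transpose :: "complex^'n^'m \<Rightarrow> complex^'m^'n"  ("(_\<^sup>H)" [1000] 999)
  where "A\<^sup>H = (\<chi> i j. cnj (A $ j $ i))"

definition skew_hermitian :: "(complex^'n^'n) set"
  where "skew_hermitian = {X. X\<^sup>H = - X}"

definition unitary_group :: "(complex^'n^'n) set"
  where "unitary_group = {U. U ** U\<^sup>H = mat 1 \<and> U\<^sup>H ** U = mat 1}"

definition commutator :: "complex^'n^'n \<Rightarrow> complex^'n^'n \<Rightarrow> complex^'n^'n"
  where "commutator A B = A ** B - B ** A"

text \<open>The norm is a total function on all complex matrices, but it is constrained only on
  the skew-Hermitian ones; its values elsewhere are arbitrary. Homogeneity is required for
  nonnegative real scalars only, so possibly N (- X) and N X differ.\<close>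

definition Ad_invariant_Finsler_norm :: "(complex^'n^'n \<Rightarrow> real) \<Rightarrow> bool"
  where "Ad_invariant_Finsler_norm N \<longleftrightarrow>
    (\<forall>X\<in>skew_hermitian. 0 \<le> N X) \<and>
    (\<forall>X\<in>skew_hermitian. N X = 0 \<longleftrightarrow> X = 0) \<and>
    (\<forall>X\<in>skew_hermitian. \<forall>Y\<in>skew_hermitian. N (X + Y) \<le> N X + N Y) \<and>
    (\<forall>X\<in>skew_hermitian. \<forall>c\<ge>0. N (c *\<^sub>R X) = c * N X) \<and>
    (\<forall>X\<in>skew_hermitian. \<forall>U\<in>unitary_group. N (U ** X ** U\<^sup>H) = N X)"

end

theory Submission
  imports Defs
begin

text \<open>
  Write \<open>L = [X, \<cdot>]\<close>. The Cayley transform of \<open>hX\<close> is a unitary matrix whose adjoint action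
  sends \<open>(1 - hX) V (1 + hX)\<close> to \<open>(1 + hX) V (1 - hX)\<close>. Hence
  \<open>V - h\<^sup>2 XVX \<mp> hLV\<close> have the same norm, so \<open>\<parallel>V\<parallel> \<le> \<parallel>V + hLV\<parallel> + O(h\<^sup>2)\<close>. Convexity along the
  segment from \<open>V\<close> to \<open>V + LV\<close> removes the error as \<open>h \<rightarrow> 0\<close>, giving \<open>\<parallel>V\<parallel> \<le> \<parallel>V + LV\<parallel>\<close>.
  The double commutator follows from the factorization \<open>1 - r\<^sup>2L\<^sup>2 = (1 - rL)(1 + rL)\<close>, and the
  monotonicity from convexity.
\<close>

section \<open>Algebra of products, conjugate transposes and commutators\<close>

lemma matrix_mul_add_left: "(A + B) ** (C :: complex^'n^'m) = A ** C + B ** C"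
  by (vector matrix_matrix_mult_def sum.distrib[symmetric] field_simps)

lemma matrix_mul_diff_right: "(A :: complex^'m^'k) ** (B - C) = A ** B - A ** C"
  by (vector matrix_matrix_mult_def sum_subtractf[symmetric] field_simps)

lemma matrix_mul_diff_left: "(A - B) ** (C :: complex^'n^'m) = A ** C - B ** C"
  by (vector matrix_matrix_mult_def sum_subtractf[symmetric] field_simps)

lemma matrix_mul_minus_left: "(- A) ** (C :: complex^'n^'m) = - (A ** C)"
  by (vector matrix_matrix_mult_def sum_negf[symmetric])

lemma matrix_mul_minus_right: "(A :: complex^'m^'k) ** (- C) = - (A ** C)"
  by (vector matrix_matrix_mult_def sum_negf[symmetric])

lemma matrix_mul_scaleR_left: "(c *\<^sub>R A) ** (C :: complex^'n^'m) = c *\<^sub>R (A ** C)"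
  by (simp add: scalar_matrix_assoc)

lemma matrix_mul_scaleR_right: "(A :: complex^'m^'k) ** (c *\<^sub>R C) = c *\<^sub>R (A ** C)"
  by (simp add: matrix_scalar_ac scalar_matrix_assoc)

lemmas matrix_mul_bilinear =
  matrix_add_ldistrib matrix_mul_add_left matrix_mul_diff_right matrix_mul_diff_left
  matrix_mul_minus_left matrix_mul_minus_right matrix_mul_scaleR_left matrix_mul_scaleR_right

lemma conj_transpose_add: "(A + B)\<^sup>H = A\<^sup>H + B\<^sup>H"
  by (simp add: conj_transpose_def vec_eq_iff)

lemma conj_transpose_diff: "(A - B)\<^sup>H = A\<^sup>H - B\<^sup>H"
  by (simp add: conj_transpose_def vec_eq_iff)

lemma conj_transpose_minus: "(- A)\<^sup>H = - A\<^sup>H"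
  by (simp add: conj_transpose_def vec_eq_iff)

lemma conj_transpose_scaleR: "(c *\<^sub>R A)\<^sup>H = c *\<^sub>R A\<^sup>H"
  by (simp add: conj_transpose_def vec_eq_iff)

lemma conj_transpose_mult: "(A ** B)\<^sup>H = B\<^sup>H ** A\<^sup>H"
  by (simp add: conj_transpose_def vec_eq_iff matrix_matrix_mult_def mult.commute)

lemma conj_transpose_mat_1: "(mat 1)\<^sup>H = mat 1"
  by (simp add: conj_transpose_def vec_eq_iff mat_def)

lemma skew_hermitian_add: "X \<in> skew_hermitian \<Longrightarrow> Y \<in> skew_hermitian \<Longrightarrow> X + Y \<in> skew_hermitian"
  by (simp add: skew_hermitian_def conj_transpose_add)

lemma skew_hermitian_minus: "X \<in> skew_hermitian \<Longrightarrow> - X \<in> skew_hermitian"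
  by (simp add: skew_hermitian_def conj_transpose_minus)

lemma skew_hermitian_scaleR: "X \<in> skew_hermitian \<Longrightarrow> c *\<^sub>R X \<in> skew_hermitian"
  by (simp add: skew_hermitian_def conj_transpose_scaleR)

lemma skew_hermitian_commutator:
  "X \<in> skew_hermitian \<Longrightarrow> Y \<in> skew_hermitian \<Longrightarrow> commutator X Y \<in> skew_hermitian"
  by (simp add: skew_hermitian_def commutator_def conj_transpose_diff conj_transpose_mult
      matrix_mul_bilinear)

lemma skew_hermitian_sandwich:
  "X \<in> skew_hermitian \<Longrightarrow> Y \<in> skew_hermitian \<Longrightarrow> X ** Y ** X \<in> skew_hermitian"
  by (simp add: skew_hermitian_def conj_transpose_mult matrix_mul_bilinear matrix_mul_assoc)

lemma commutator_scaleR_left: "commutator (c *\<^sub>R X) V = c *\<^sub>R commutator X V"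
  by (simp add: commutator_def matrix_mul_bilinear scaleR_diff_right)

lemma commutator_scaleR_right: "commutator X (c *\<^sub>R V) = c *\<^sub>R commutator X V"
  by (simp add: commutator_def matrix_mul_bilinear scaleR_diff_right)

lemma commutator_add_right: "commutator X (V + W) = commutator X V + commutator X W"
  by (simp add: commutator_def matrix_mul_bilinear)

section \<open>Skew-Hermitian matrices and the Cayley transform\<close>

lemma inner_matrix_vector_mult_conj_transpose:
  fixes A :: "complex^'n^'m"
  shows "x \<bullet> (A *v y) = (A\<^sup>H *v x) \<bullet> y"
proof -
  \<comment> \<open>The real inner product of complex numbers is the real part of
    \<open>cnj a * b\<close>, so the adjoint for it is the conjugate transpose.\<close>
  have *: "a \<bullet> (b * c) = (cnj b * a) \<bullet> c" for a b c :: complex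
    by (simp add: inner_complex_def algebra_simps)
  show ?thesis
    unfolding inner_vec_def matrix_vector_mult_def conj_transpose_def
    by (simp add: inner_sum_left inner_sum_right *) (rule sum.swap)
qed

lemma inner_skew_hermitian_self:
  assumes "X \<in> skew_hermitian"
  shows "v \<bullet> (X *v v) = 0"
proof -
  have "(- X) *v v = - (X *v v)"
    by (simp add: matrix_vector_mult_def vec_eq_iff sum_negf)
  then have "v \<bullet> (X *v v) = - (v \<bullet> (X *v v))"
    using assms inner_matrix_vector_mult_conj_transpose[of v X v]
    by (simp add: skew_hermitian_def inner_commute)
  then show ?thesis by simp
qed

text \<open>A vector fixed by \<open>X\<close> is orthogonal to itself, because \<open>X\<close>
  maps each vector to an orthogonal one. So \<open>mat 1 - X\<close> is injective, and a square
  matrix with a left inverse is invertible.\<close>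

lemma one_minus_skew_hermitian_invertible:
  assumes "X \<in> skew_hermitian"
  obtains B where "B ** (mat 1 - X) = mat 1" "(mat 1 - X) ** B = mat 1"
proof -
  have "inj ((*v) (mat 1 - X))"
  proof (rule injI)
    fix u v assume "(mat 1 - X) *v u = (mat 1 - X) *v v"
    then have "u - v = X *v (u - v)"
      by (simp add: matrix_vector_mult_diff_rdistrib matrix_vector_mult_diff_distrib algebra_simps)
    then have "(u - v) \<bullet> (u - v) = 0"
      using inner_skew_hermitian_self[OF assms, of "u - v"] by simp
    then show "u = v" by simp
  qed
  then obtain B where "B ** (mat 1 - X) = mat 1"
    using matrix_left_invertible_injective by blast
  with that show thesis by (simp add: matrix_left_right_inverse)
qed

text \<open>Take \<open>U\<close> to be (1 + X)(1 - X)^(-1). The conjugate transpose swaps 1 + X and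
  1 - X, and these commute, which makes \<open>U\<close> unitary. On the left \<open>U\<close> turns
  1 - X into 1 + X; on the right \<open>U\<^sup>H\<close> turns 1 + X into 1 - X.\<close>

lemma cayley_transform:
  fixes X :: "complex^'n^'n"
  assumes X: "X \<in> skew_hermitian"
  obtains U where "U \<in> unitary_group"
    and "\<And>W. U ** ((mat 1 - X) ** W ** (mat 1 + X)) ** U\<^sup>H = (mat 1 + X) ** W ** (mat 1 - X)"
proof -
  define P where "P = mat 1 + X"
  define M where "M = mat 1 - X"
  obtain B where BM: "B ** M = mat 1" and MB: "M ** B = mat 1"
    using one_minus_skew_hermitian_invertible[OF X] unfolding M_def by blast
  have PH: "P\<^sup>H = M" and MH: "M\<^sup>H = P"
    using X by (simp_all add: P_def M_def skew_hermitian_def conj_transpose_add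
        conj_transpose_diff conj_transpose_mat_1)
  have PB: "P ** B\<^sup>H = mat 1" and BP: "B\<^sup>H ** P = mat 1"
    using arg_cong[OF BM, of conj_transpose] arg_cong[OF MB, of conj_transpose]
    by (simp_all add: conj_transpose_mult conj_transpose_mat_1 MH)
  have PM: "P ** M = M ** P"
    by (simp add: P_def M_def matrix_mul_bilinear)
  \<comment> \<open>\<open>P\<close> commutes with \<open>M\<close>, hence with its inverse
    \<open>B\<close>.\<close>
  have "B ** P = B ** (P ** M) ** B"
    by (metis MB matrix_mul_assoc matrix_mul_rid)
  also have "\<dots> = P ** B"
    unfolding PM by (simp add: matrix_mul_assoc BM)
  finally have comm: "B ** P = P ** B" .
  define U where "U = P ** B"
  have UH: "U\<^sup>H = B\<^sup>H ** M"
    by (simp add: U_def conj_transpose_mult PH)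
  have "U ** U\<^sup>H = B ** (P ** B\<^sup>H) ** M"
    unfolding UH by (simp add: U_def comm[symmetric] matrix_mul_assoc)
  then have 1: "U ** U\<^sup>H = mat 1" by (simp add: PB BM)
  then have "U \<in> unitary_group"
    using matrix_left_right_inverse[of U "U\<^sup>H"] by (simp add: unitary_group_def)
  moreover have "U ** (M ** W ** P) ** U\<^sup>H = P ** W ** M" for W
  proof -
    have "U ** (M ** W ** P) ** U\<^sup>H = P ** (B ** M) ** W ** (P ** B\<^sup>H) ** M"
      unfolding UH by (simp add: U_def matrix_mul_assoc)
    then show ?thesis by (simp add: BM PB)
  qed
  ultimately show thesis using that unfolding P_def M_def by blast
qed

section \<open>Norm inequalities from convexity and Ad-invariance\<close>

context
  fixes N :: "complex^'n^'n \<Rightarrow> real"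
  assumes N: "Ad_invariant_Finsler_norm N"
begin

lemma Finsler_triangle:
  "X \<in> skew_hermitian \<Longrightarrow> Y \<in> skew_hermitian \<Longrightarrow> N (X + Y) \<le> N X + N Y"
  using N by (simp add: Ad_invariant_Finsler_norm_def)

lemma Finsler_scaleR: "X \<in> skew_hermitian \<Longrightarrow> 0 \<le> c \<Longrightarrow> N (c *\<^sub>R X) = c * N X"
  using N by (simp add: Ad_invariant_Finsler_norm_def)

lemma Finsler_conjugate:
  "X \<in> skew_hermitian \<Longrightarrow> U \<in> unitary_group \<Longrightarrow> N (U ** X ** U\<^sup>H) = N X"
  using N by (simp add: Ad_invariant_Finsler_norm_def)

lemma Finsler_convex:
  assumes V: "V \<in> skew_hermitian" and D: "D \<in> skew_hermitian" and c: "0 \<le> c" "c \<le> 1"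
  shows "N (V + c *\<^sub>R D) \<le> (1 - c) * N V + c * N (V + D)"
proof -
  have "V + c *\<^sub>R D = (1 - c) *\<^sub>R V + c *\<^sub>R (V + D)"
    by (simp add: algebra_simps)
  also have "N \<dots> \<le> N ((1 - c) *\<^sub>R V) + N (c *\<^sub>R (V + D))"
    by (intro Finsler_triangle skew_hermitian_scaleR skew_hermitian_add V D)
  also have "\<dots> = (1 - c) * N V + c * N (V + D)"
    using c by (simp add: Finsler_scaleR V D skew_hermitian_add)
  finally show ?thesis .
qed

text \<open>The chord bound of convexity is at most its larger endpoint value, here the one at
  \<open>V + D\<close>. Both monotonicity claims come from this.\<close>

lemma Finsler_mono_segment:
  assumes V: "V \<in> skew_hermitian" and D: "D \<in> skew_hermitian"
    and c: "0 \<le> c" "c \<le> 1" and le: "N V \<le> N (V + D)"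
  shows "N (V + c *\<^sub>R D) \<le> N (V + D)"
proof -
  have "(1 - c) * N V \<le> (1 - c) * N (V + D)"
    using c le by (intro mult_left_mono) auto
  with Finsler_convex[OF V D c] show ?thesis by (simp add: algebra_simps)
qed

lemma Finsler_cayley_symmetry:
  assumes X: "X \<in> skew_hermitian" and V: "V \<in> skew_hermitian"
  shows "N (V - X ** V ** X - commutator X V) = N (V - X ** V ** X + commutator X V)"
proof -
  obtain U where U: "U \<in> unitary_group"
    and conj: "\<And>W. U ** ((mat 1 - X) ** W ** (mat 1 + X)) ** U\<^sup>H
      = (mat 1 + X) ** W ** (mat 1 - X)"
    using cayley_transform[OF X] by blast
  have minus: "(mat 1 - X) ** V ** (mat 1 + X) = V - X ** V ** X - commutator X V"
    by (simp add: commutator_def matrix_mul_bilinear matrix_mul_assoc)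
  have plus: "(mat 1 + X) ** V ** (mat 1 - X) = V - X ** V ** X + commutator X V"
    by (simp add: commutator_def matrix_mul_bilinear matrix_mul_assoc)
  have "V - X ** V ** X - commutator X V \<in> skew_hermitian"
    using skew_hermitian_add[OF skew_hermitian_add[OF V
          skew_hermitian_minus[OF skew_hermitian_sandwich[OF X V]]]
        skew_hermitian_minus[OF skew_hermitian_commutator[OF X V]]]
    by simp
  from Finsler_conjugate[OF this U] show ?thesis
    using conj[of V] unfolding minus plus by simp
qed

text \<open>Split 2V as (V + C) + (V - C), where C is the commutator. The Cayley symmetry trades V -
  C for V + C at the cost of subtracting and restoring XVX. Both signs of XVX appear since
  \<open>N\<close> need not be even.\<close>

lemma Finsler_le_add_commutator_approx:
  assumes X: "X \<in> skew_hermitian" and V: "V \<in> skew_hermitian"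
  shows "2 * N V \<le> 2 * N (V + commutator X V) + (N (X ** V ** X) + N (- (X ** V ** X)))"
proof -
  let ?S = "X ** V ** X" and ?C = "commutator X V"
  have S: "?S \<in> skew_hermitian" and C: "?C \<in> skew_hermitian"
    using X V by (auto intro: skew_hermitian_sandwich skew_hermitian_commutator)
  note sk = V S C skew_hermitian_add skew_hermitian_minus
  have VC: "V + ?C \<in> skew_hermitian" "V + - ?C \<in> skew_hermitian"
    "V + - ?S + - ?C \<in> skew_hermitian"
    using sk by blast+
  have "2 * N V = N (2 *\<^sub>R V)" using V by (simp add: Finsler_scaleR)
  also have "2 *\<^sub>R V = (V + ?C) + (V + - ?C)" by (simp add: scaleR_2)
  also have "N \<dots> \<le> N (V + ?C) + N (V + - ?C)"
    by (intro Finsler_triangle VC)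
  also have "V + - ?C = (V + - ?S + - ?C) + ?S" by simp
  also have "N \<dots> \<le> N (V + - ?S + - ?C) + N ?S"
    by (intro Finsler_triangle VC S)
  also have "N (V + - ?S + - ?C) = N ((V + ?C) + - ?S)"
    using Finsler_cayley_symmetry[OF X V] by (simp add: algebra_simps)
  also have "\<dots> \<le> N (V + ?C) + N (- ?S)"
    by (intro Finsler_triangle VC S skew_hermitian_minus)
  finally show ?thesis by simp
qed

text \<open>Suppose the norm dropped by \<open>d\<close> from \<open>V\<close> to
  \<open>V + commutator X V\<close>. By convexity it drops by at least \<open>h * d\<close> at step
  \<open>h\<close>, while replacing \<open>X\<close> by \<open>h *\<^sub>R X\<close> makes the error
  in the approximate bound quadratic in \<open>h\<close>. A small \<open>h\<close> is
  contradictory.\<close>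

lemma Finsler_le_add_commutator:
  assumes X: "X \<in> skew_hermitian" and V: "V \<in> skew_hermitian"
  shows "N V \<le> N (V + commutator X V)"
proof (rule ccontr)
  let ?S = "X ** V ** X" and ?C = "commutator X V"
  define K where "K = N ?S + N (- ?S)"
  define d where "d = N V - N (V + ?C)"
  assume "\<not> ?thesis"
  then have d: "d > 0" by (simp add: d_def)
  have S: "?S \<in> skew_hermitian" and C: "?C \<in> skew_hermitian"
    using X V by (auto intro: skew_hermitian_sandwich skew_hermitian_commutator)
  have K: "K \<ge> 0"
    using N S skew_hermitian_minus[OF S] by (simp add: K_def Ad_invariant_Finsler_norm_def)
  \<comment> \<open>The bound to refute is \<open>2 * d \<le> h * K\<close>. This \<open>h\<close>
    gives \<open>h * K \<le> d\<close> and stays in (0, 1], also when \<open>K\<close> is 0.\<close>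
  define h where "h = d / (K + d)"
  have h: "0 < h" "h \<le> 1" using d K by (auto simp: h_def)
  have "(h *\<^sub>R X) ** V ** (h *\<^sub>R X) = (h * h) *\<^sub>R ?S"
    by (simp add: matrix_mul_bilinear)
  moreover have "N ((h * h) *\<^sub>R ?S) + N (- ((h * h) *\<^sub>R ?S)) = h * h * K"
    using Finsler_scaleR[OF S, of "h * h"] Finsler_scaleR[OF skew_hermitian_minus[OF S], of "h * h"]
    by (simp add: K_def algebra_simps)
  ultimately have "2 * N V \<le> 2 * N (V + h *\<^sub>R ?C) + h * h * K"
    using Finsler_le_add_commutator_approx[OF skew_hermitian_scaleR[OF X, of h] V]
    by (simp add: commutator_scaleR_left)
  moreover have "N (V + h *\<^sub>R ?C) \<le> N V - h * d"
    using Finsler_convex[OF V C, of h] h by (simp add: d_def algebra_simps)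
  ultimately have "h * (2 * d) \<le> h * (h * K)" by (simp add: algebra_simps)
  then have "2 * d \<le> h * K" using h by simp
  moreover have "h * K \<le> d"
    using d K by (simp add: h_def divide_simps algebra_simps)
  ultimately show False using d by simp
qed

lemma Finsler_le_diff_double_commutator:
  assumes X: "X \<in> skew_hermitian" and V: "V \<in> skew_hermitian" and s: "0 \<le> s"
  shows "N V \<le> N (V - s *\<^sub>R commutator X (commutator X V))"
proof -
  \<comment> \<open>The square root makes the double commutator with \<open>Y\<close> equal to
    \<open>s\<close> times that with \<open>X\<close>. The linear inequality is used for
    \<open>Y\<close> at \<open>V\<close>, then for \<open>- Y\<close> at \<open>W\<close>.\<close>
  define Y where "Y = sqrt s *\<^sub>R X"
  have Y: "Y \<in> skew_hermitian" using X by (simp add: Y_def skew_hermitian_scaleR)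
  define W where "W = V + commutator Y V"
  have W: "W \<in> skew_hermitian"
    by (simp add: W_def V Y skew_hermitian_add skew_hermitian_commutator)
  have neg: "commutator (- Y) Z = - commutator Y Z" for Z
    using commutator_scaleR_left[of "-1" Y Z] by simp
  have "N V \<le> N W"
    unfolding W_def by (rule Finsler_le_add_commutator[OF Y V])
  also have "\<dots> \<le> N (W + commutator (- Y) W)"
    by (rule Finsler_le_add_commutator[OF skew_hermitian_minus[OF Y] W])
  also have "W + commutator (- Y) W = V - commutator Y (commutator Y V)"
    by (simp add: neg) (simp add: W_def commutator_add_right)
  also have "\<dots> = V - s *\<^sub>R commutator X (commutator X V)"
    using s by (simp add: Y_def commutator_scaleR_left commutator_scaleR_right)
  finally show ?thesis .
qed

end

theorem theorem3p8:
  fixes N :: "complex^'n^'n \<Rightarrow> real" and X V :: "complex^'n^'n"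
  assumes "X \<in> skew_hermitian" and "V \<in> skew_hermitian"
    and "Ad_invariant_Finsler_norm N"
  shows "(\<forall>s s' :: real. 0 \<le> s \<and> s \<le> s' \<longrightarrow>
            N V \<le> N (V - s *\<^sub>R commutator X (commutator X V)) \<and>
            N (V - s *\<^sub>R commutator X (commutator X V))
              \<le> N (V - s' *\<^sub>R commutator X (commutator X V))) \<and>
         (\<forall>t t' :: real. t \<noteq> 0 \<and> t' / t \<ge> 1 \<longrightarrow>
            N V \<le> N (V + t *\<^sub>R commutator X V) \<and>
            N (V + t *\<^sub>R commutator X V) \<le> N (V + t' *\<^sub>R commutator X V))"
proof (intro conjI allI impI; elim conjE)
  note X = assms(1) and V = assms(2) and N = assms(3)
  let ?C = "commutator X V"
  let ?CC = "commutator X ?C"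
  have C: "?C \<in> skew_hermitian" and CC: "?CC \<in> skew_hermitian"
    using X V by (auto intro: skew_hermitian_commutator)
  \<comment> \<open>The scalar is absorbed into \<open>X\<close>, which stays skew-Hermitian for
    either sign of \<open>t\<close>.\<close>
  have linear: "N V \<le> N (V + t *\<^sub>R ?C)" for t
    using Finsler_le_add_commutator[OF N skew_hermitian_scaleR[OF X] V]
    by (simp add: commutator_scaleR_left)
  {
    fix s s' :: real
    assume s: "0 \<le> s" "s \<le> s'"
    show "N V \<le> N (V - s *\<^sub>R ?CC)"
      by (rule Finsler_le_diff_double_commutator[OF N X V s(1)])
    \<comment> \<open>If \<open>s'\<close> is 0 then so is \<open>s\<close>, and the witness
      \<open>s / s'\<close> is 0 by the convention for division by zero.\<close>
    obtain c where c: "0 \<le> c" "c \<le> 1" "c * s' = s"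
    proof
      show "0 \<le> s / s'" "s / s' \<le> 1" "s / s' * s' = s"
        using s by (auto simp: divide_simps)
    qed
    have le: "N V \<le> N (V + (- s') *\<^sub>R ?CC)"
      using Finsler_le_diff_double_commutator[OF N X V, of s'] s by simp
    from Finsler_mono_segment[OF N V skew_hermitian_scaleR[OF CC] c(1,2) le]
    show "N (V - s *\<^sub>R ?CC) \<le> N (V - s' *\<^sub>R ?CC)"
      unfolding c(3)[symmetric] by simp
  }
  {
    fix t t' :: real
    assume t: "t \<noteq> 0" "1 \<le> t' / t"
    show "N V \<le> N (V + t *\<^sub>R ?C)" by (rule linear)
    have "t' \<noteq> 0" using t by auto
    \<comment> \<open>The condition on \<open>t' / t\<close> says that \<open>t\<close> and
      \<open>t'\<close> have the same sign and \<open>t'\<close> is at least as far from 0, so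
      \<open>t / t'\<close> lies in (0, 1].\<close>
    obtain c where c: "0 \<le> c" "c \<le> 1" "c * t' = t"
    proof
      show "0 \<le> t / t'" "t / t' \<le> 1" "t / t' * t' = t"
        using t \<open>t' \<noteq> 0\<close> by (auto simp: divide_simps split: if_splits)
    qed
    from Finsler_mono_segment[OF N V skew_hermitian_scaleR[OF C] c(1,2) linear]
    show "N (V + t *\<^sub>R ?C) \<le> N (V + t' *\<^sub>R ?C)"
      unfolding c(3)[symmetric] by simp
  }
qed

end
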